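(* Let $n,m\in\mathbb{Z}_{>0}$, $A\in\mathbb{R}^{n\times n}$, $B\in\mathbb{R}^{n\times m}$ with $(A,B)$ stabilizable, and let $Q\in\mathbb{R}^{n\times n}$, $R\in\mathbb{R}^{m\times m}$ be symmetric with $Q\succ 0$ and $R\succ 0$. Let $\gamma\in[0,1]$ and $K_0\in\mathcal{K}_1$. The algorithm sPI (described in the context), initialized at $K_0$, satisfies the following properties. (i) (Recursive feasibility) For any $j\in\mathbb{Z}_{>0}$, given the pair $(K_{j-1},P_{j-1})$ generated by the algorithm at the previous step, there always exist $\alpha_j\in(0,1]$, $K_j\in\mathcal{K}_1$ and a symmetric matrix $P_j$ such that $$K_j=\alpha_j\left(-\gamma(R+\gamma B^\top P_{j-1}B)^{-1}B^\top P_{j-1}A\right)+(1-\alpha_j)K_{j-1}$$ and $$\sqrt{\gamma}(A+BK_j)^\top P_j\sqrt{\gamma}(A+BK_j)-P_j+K_j^\top RK_j+Q=0.$$ (ii) (Recursive cost improvement) For any sequence generated by the algorithm and any $j\in\mathbb{Z}_{>0}$, $P_j\preceq P_{j-1}$, implying that $J_\gamma(x_0,K_j)-J_\gamma(x_0,K_{j-1})\le0$ for any $x_0\in\mathbb{R}^n$.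
   Context: $\rho(M)$ denotes the spectral radius of a square matrix $M$; $\succ0$ (resp. $\succeq 0$) means symmetric positive definite (resp. semidefinite), and $M\preceq N$ means $N-M\succeq0$. $(A,B)$ stabilizable means there is $K\in\mathbb{R}^{m\times n}$ with $\rho(A+BK)<1$. $\mathcal{K}_1:=\{K\in\mathbb{R}^{m\times n}:\rho(A+BK)<1\}$. For $K\in\mathbb{R}^{m\times n}$, $J_\gamma(x_0,K):=\sum_{k=0}^\infty\gamma^k\,(x_k^\top Qx_k+u_k^\top Ru_k)$, where $x_{k+1}=Ax_k+Bu_k$, $u_k=Kx_k$ for all $k\ge0$, with initial state $x_0$ (convention $0^0=1$). Algorithm sPI. Input: $K_0\in\mathcal{K}_1$, $\gamma\in[0,1]$, $A,B,Q,R$. Initial evaluation step: let $P_0$ be the solution of $\sqrt{\gamma}(A+BK_0)^\top P_0\sqrt{\gamma}(A+BK_0)-P_0+K_0^\top RK_0+Q=0$. For each $j=1,2,\dots$: Improvement step: select any $\alpha_j\in(0,1]$ such that $K_j\in\mathcal{K}_1$, where $K_j=\alpha_j\left(-\gamma(R+\gamma B^\top P_{j-1}B)^{-1}B^\top P_{j-1}A\right)+(1-\alpha_j)K_{j-1}$. Evaluation step: let $P_j$ be the solution of $\sqrt{\gamma}(A+BK_j)^\top P_j\sqrt{\gamma}(A+BK_j)-P_j+K_j^\top RK_j+Q=0$. (For $K_j\in\mathcal{K}_1$ this Lyapunov equation has a unique solution, which is symmetric positive definite.) *)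

theory Defs
  imports "HOL-Analysis.Analysis"
begin

text \<open>An \<open>r \<times> c\<close> real matrix has type \<open>real^'c^'r\<close>; thus \<open>A :: real^'n^'n\<close>,
  \<open>B :: real^'m^'n\<close> and \<open>K :: real^'n^'m\<close>. The eigenvalues of a real matrix are those of
  its complexification.\<close>

definition complexify :: "real^'c^'r \<Rightarrow> complex^'c^'r" where
  "complexify M = (\<chi> i j. complex_of_real (M $ i $ j))"

definition complex_eigenvalues :: "real^'n^'n \<Rightarrow> complex set" where
  "complex_eigenvalues M = {l. \<exists>v. v \<noteq> 0 \<and> complexify M *v v = l *s v}"

definition spec_radius :: "real^'n^'n \<Rightarrow> real" where
  "spec_radius M = Max (cmod ` complex_eigenvalues M)"

definition symmetric_matrix :: "real^'n^'n \<Rightarrow> bool" where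
  "symmetric_matrix M \<longleftrightarrow> transpose M = M"

definition pos_def :: "real^'n^'n \<Rightarrow> bool" where
  "pos_def M \<longleftrightarrow> symmetric_matrix M \<and> (\<forall>x. x \<noteq> 0 \<longrightarrow> 0 < x \<bullet> (M *v x))"

definition pos_semidef :: "real^'n^'n \<Rightarrow> bool" where
  "pos_semidef M \<longleftrightarrow> symmetric_matrix M \<and> (\<forall>x. 0 \<le> x \<bullet> (M *v x))"

definition loewner_le :: "real^'n^'n \<Rightarrow> real^'n^'n \<Rightarrow> bool" where
  "loewner_le M N \<longleftrightarrow> pos_semidef (N - M)"

definition stabilizing_gains :: "real^'n^'n \<Rightarrow> real^'m^'n \<Rightarrow> (real^'n^'m) set" where
  "stabilizing_gains A B = {K. spec_radius (A + B ** K) < 1}"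

definition stabilizable :: "real^'n^'n \<Rightarrow> real^'m^'n \<Rightarrow> bool" where
  "stabilizable A B \<longleftrightarrow> (\<exists>K. spec_radius (A + B ** K) < 1)"

primrec closed_loop_state ::
  "real^'n^'n \<Rightarrow> real^'m^'n \<Rightarrow> real^'n^'m \<Rightarrow> real^'n \<Rightarrow> nat \<Rightarrow> real^'n" where
  "closed_loop_state A B K x0 0 = x0"
| "closed_loop_state A B K x0 (Suc k) =
     A *v closed_loop_state A B K x0 k + B *v (K *v closed_loop_state A B K x0 k)"

definition discounted_cost ::
  "real^'n^'n \<Rightarrow> real^'m^'n \<Rightarrow> real^'n^'n \<Rightarrow> real^'m^'m \<Rightarrow> real \<Rightarrow> real^'n \<Rightarrow> real^'n^'m \<Rightarrow> real" where
  "discounted_cost A B Q R \<gamma> x0 K =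
     (\<Sum>k. \<gamma> ^ k *
        (let x = closed_loop_state A B K x0 k; u = K *v x
         in x \<bullet> (Q *v x) + u \<bullet> (R *v u)))"

definition lyapunov_solution ::
  "real^'n^'n \<Rightarrow> real^'m^'n \<Rightarrow> real^'n^'n \<Rightarrow> real^'m^'m \<Rightarrow> real \<Rightarrow> real^'n^'m \<Rightarrow> real^'n^'n \<Rightarrow> bool" where
  "lyapunov_solution A B Q R \<gamma> K P \<longleftrightarrow>
     (sqrt \<gamma> *\<^sub>R transpose (A + B ** K)) ** P ** (sqrt \<gamma> *\<^sub>R (A + B ** K))
       - P + transpose K ** R ** K + Q = 0"

definition improved_gain ::
  "real^'n^'n \<Rightarrow> real^'m^'n \<Rightarrow> real^'m^'m \<Rightarrow> real \<Rightarrow> real^'n^'n \<Rightarrow> real \<Rightarrow> real^'n^'m \<Rightarrow> real^'n^'m" where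
  "improved_gain A B R \<gamma> P \<alpha> K =
     \<alpha> *\<^sub>R (- (\<gamma> *\<^sub>R (matrix_inv (R + \<gamma> *\<^sub>R (transpose B ** P ** B)) ** transpose B ** P ** A)))
       + (1 - \<alpha>) *\<^sub>R K"

text \<open>\<open>sPI_run A B Q R \<gamma> K0 N \<alpha> K P\<close>: the first entries \<open>\<alpha> 1, \<dots>, \<alpha> N\<close>,
  \<open>K 0, \<dots>, K N\<close>, \<open>P 0, \<dots>, P N\<close> are a possible outcome of \<open>N\<close> iterations started at \<open>K0\<close>;
  later entries (and \<open>\<alpha> 0\<close>) are unconstrained.\<close>

definition sPI_run ::
  "real^'n^'n \<Rightarrow> real^'m^'n \<Rightarrow> real^'n^'n \<Rightarrow> real^'m^'m \<Rightarrow> real \<Rightarrow> real^'n^'m \<Rightarrow> nat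
    \<Rightarrow> (nat \<Rightarrow> real) \<Rightarrow> (nat \<Rightarrow> real^'n^'m) \<Rightarrow> (nat \<Rightarrow> real^'n^'n) \<Rightarrow> bool" where
  "sPI_run A B Q R \<gamma> K0 N \<alpha> K P \<longleftrightarrow>
     K 0 = K0 \<and> lyapunov_solution A B Q R \<gamma> (K 0) (P 0) \<and>
     (\<forall>j\<in>{1..N}.
        \<alpha> j \<in> {0<..1} \<and>
        K j = improved_gain A B R \<gamma> (P (j - 1)) (\<alpha> j) (K (j - 1)) \<and>
        K j \<in> stabilizing_gains A B \<and>
        lyapunov_solution A B Q R \<gamma> (K j) (P j))"

end

theory Submission
  imports Defs "HOL-Computational_Algebra.Fundamental_Theorem_Algebra"
begin

text \<open>Write \<open>F\<close> for the closed-loop matrix \<open>A + B K\<close>, possibly scaled by \<open>\<surd>\<gamma>\<close>. Stability enters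
  only through the convergence \<open>F\<^sup>k x \<longrightarrow> 0\<close>, obtained from \<open>\<rho>(F) < 1\<close> by splitting an annihilating
  polynomial into linear factors. It makes \<open>X \<mapsto> F\<^sup>T X F - X\<close> injective, hence bijective, so the
  Lyapunov equation is uniquely solvable; and it makes every form \<open>D\<close> with \<open>F\<^sup>T D F \<preceq> D\<close> positive
  semidefinite.

  Feasibility: the form solving \<open>F\<^sup>T P F - P + I = 0\<close> still decreases strictly along \<open>F + \<alpha> N\<close>
  for small \<open>\<alpha> > 0\<close>, which forces all eigenvalues of \<open>F + \<alpha> N\<close> into the open unit disc.

  Improvement: completing the square shows that a step towards the greedy gain does not increase
  the one-step cost-to-go with terminal form \<open>P\<^bsub>j-1\<^esub>\<close>, so \<open>D = P\<^bsub>j-1\<^esub> - P\<^bsub>j\<^esub>\<close> satisfies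
  \<open>\<gamma> (A + B K\<^bsub>j\<^esub>)\<^sup>T D (A + B K\<^bsub>j\<^esub>) \<preceq> D\<close>. Telescoping the Lyapunov equation along a trajectory
  identifies the cost with \<open>x\<^sub>0\<^sup>T P x\<^sub>0\<close>.\<close>

section \<open>Spectrum and convergence of powers\<close>

text \<open>Horner evaluation of \<open>p(M) v\<close>. Acting on a vector directly avoids forming
  \<open>p(M)\<close> as a matrix.\<close>

definition poly_action :: "complex^'n^'n \<Rightarrow> complex poly \<Rightarrow> complex^'n \<Rightarrow> complex^'n" where
  "poly_action M p v = fold_coeffs (\<lambda>a w. a *s v + M *v w) p 0"

lemma poly_action_0 [simp]: "poly_action M 0 v = 0"
  by (simp add: poly_action_def)

lemma poly_action_pCons [simp]:
  "poly_action M (pCons a p) v = a *s v + M *v poly_action M p v"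
  by (cases "p = 0 \<and> a = 0") (auto simp: poly_action_def)

lemma poly_action_add: "poly_action M (p + q) v = poly_action M p v + poly_action M q v"
proof (induction p arbitrary: q)
  case (pCons a p)
  obtain b r where "q = pCons b r" by (cases q)
  then show ?case
    using pCons.IH[of r] by (simp add: matrix_vector_right_distrib algebra_simps)
qed simp

lemma poly_action_smult: "poly_action M (smult c p) v = c *s poly_action M p v"
  by (induction p) (simp_all add: vec.scale_right_distrib vec.scale vector_smult_assoc)

lemma poly_action_sum:
  "poly_action M (\<Sum>i\<in>I. f i) v = (\<Sum>i\<in>I. poly_action M (f i) v)"
  by (induction I rule: infinite_finite_induct) (simp_all add: poly_action_add)

lemma poly_action_monom: "poly_action M (monom c i) v = c *s ((*v) M ^^ i) v"
  by (induction i) (simp_all add: monom_0 monom_Suc vec.scale)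

lemma poly_action_linear_factor:
  "poly_action M ([:- l, 1:] * q) v = M *v poly_action M q v - l *s poly_action M q v"
proof -
  have "[:- l, 1:] * q = smult (- l) q + pCons 0 q"
    by simp
  then show ?thesis
    by (simp only: poly_action_add poly_action_smult poly_action_pCons) simp
qed

text \<open>\<open>q(M)\<close> commutes with \<open>M - l\<close>, so a linear factor can be moved
  from the polynomial to the vector.\<close>

lemma poly_action_diff_scale:
  "poly_action M q (M *v v - l *s v) = M *v poly_action M q v - l *s poly_action M q v"
  by (induction q)
    (simp_all add: matrix_vector_mult_diff_distrib matrix_vector_right_distrib vec.scale
      vec.scale_right_distrib vec.scale_right_diff_distrib vector_smult_assoc mult.commute)

lemma poly_action_eigenvector:
  assumes "M *v v = l *s v"
  shows "poly_action M p v = poly p l *s v"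
  by (induction p)
    (simp_all add: assms vec.scale vector_smult_assoc vec.scale_left_distrib mult.commute)

lemma matrix_vector_funpow:
  fixes M :: "'a::semiring_1^'n^'n"
  shows "((**) M ^^ i) (mat 1) *v v = ((*v) M ^^ i) v"
  by (induction i) (simp_all flip: matrix_vector_mul_assoc)

text \<open>The powers of \<open>M\<close> are linearly dependent already over the reals, which avoids
  treating complex matrices as a complex vector space.\<close>

lemma annihilating_poly_exists:
  fixes M :: "complex^'n^'n"
  obtains p where "p \<noteq> 0" "\<And>v. poly_action M p v = 0"
proof -
  define pw where "pw i = ((**) M ^^ i) (mat 1)" for i
  define N where "N = DIM(complex^'n^'n)"
  \<comment> \<open>\<open>N + 1\<close> elements of a space of real dimension \<open>N\<close> are
    dependent. As \<open>dependent\<close> speaks about sets, a repeated power is treated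
    separately, with coefficients \<open>1\<close> and \<open>-1\<close>.\<close>
  have "\<exists>c::nat \<Rightarrow> real. (\<exists>i\<le>N. c i \<noteq> 0) \<and> (\<Sum>i\<le>N. c i *\<^sub>R pw i) = 0"
  proof (cases "inj_on pw {..N}")
    case True
    then have "card (pw ` {..N}) > DIM(complex^'n^'n)"
      by (simp add: card_image N_def)
    then have "dependent (pw ` {..N})"
      using dependent_biggerset by blast
    then obtain u where u: "\<exists>w\<in>pw ` {..N}. u w \<noteq> 0" "(\<Sum>w\<in>pw ` {..N}. u w *\<^sub>R w) = 0"
      using dependent_finite[of "pw ` {..N}"] by auto
    then show ?thesis
      using True by (intro exI[of _ "u \<circ> pw"]) (auto simp: sum.reindex)
  next
    case False
    then obtain i j where ij: "i \<le> N" "j \<le> N" "i \<noteq> j" "pw i = pw j"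
      by (auto simp: inj_on_def)
    define c :: "nat \<Rightarrow> real" where "c k = (if k = i then 1 else 0) - (if k = j then 1 else 0)" for k
    have "(\<Sum>k\<le>N. c k *\<^sub>R pw k) = (\<Sum>k\<le>N. (if k = i then pw k else 0) - (if k = j then pw k else 0))"
      by (intro sum.cong) (auto simp: c_def)
    also have "\<dots> = 0"
      using ij by (simp add: sum_subtractf)
    finally show ?thesis
      using ij by (intro exI[of _ c]) (auto simp: c_def)
  qed
  then obtain c i where c: "i \<le> N" "c i \<noteq> (0::real)" "(\<Sum>i\<le>N. c i *\<^sub>R pw i) = 0"
    by blast
  define p where "p = (\<Sum>i\<le>N. monom (complex_of_real (c i)) i)"
  have "coeff p i = c i"
    using c(1) by (simp add: p_def coeff_sum coeff_monom)
  then have "p \<noteq> 0"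
    using c(2) by auto
  moreover have "poly_action M p v = 0" for v
  proof -
    have "poly_action M p v = (\<Sum>i\<le>N. complex_of_real (c i) *s (pw i *v v))"
      by (simp add: p_def poly_action_sum poly_action_monom pw_def matrix_vector_funpow)
    also have "\<dots> = (\<Sum>i\<le>N. c i *\<^sub>R pw i) *v v"
    proof -
      have "(\<Sum>i\<in>I. complex_of_real (c i) *s (pw i *v v)) = (\<Sum>i\<in>I. c i *\<^sub>R pw i) *v v" for I
      proof (induction I rule: infinite_finite_induct)
        case (insert x F)
        have "complex_of_real (c x) *s (pw x *v v) = (c x *\<^sub>R pw x) *v v"
          by (simp add: vec_eq_iff matrix_vector_mult_def sum_distrib_left) (simp add: scaleR_conv_of_real)
        then show ?case
          using insert by (simp add: matrix_vector_mult_add_rdistrib)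
      qed simp_all
      then show ?thesis .
    qed
    finally show ?thesis
      using c(3) by simp
  qed
  ultimately show ?thesis
    using that by blast
qed

text \<open>Split a root \<open>l\<close> off a polynomial annihilating \<open>v\<close>, leaving the cofactor \<open>q\<close>. Either \<open>q\<close>
  already annihilates \<open>v\<close>, or \<open>q\<close> maps \<open>v\<close> to an eigenvector for \<open>l\<close> and annihilates
  \<open>M *v v - l *s v\<close>.\<close>

lemma eigenvalue_induct:
  fixes M :: "complex^'n^'n"
  assumes zero: "P 0"
    and step: "\<And>l u v. u \<noteq> 0 \<Longrightarrow> M *v u = l *s u \<Longrightarrow> P (M *v v - l *s v) \<Longrightarrow> P v"
  shows "P v"
proof -
  obtain p where p: "p \<noteq> 0" "poly_action M p v = 0"
    using annihilating_poly_exists[of M] by metis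
  then show ?thesis
  proof (induction "degree p" arbitrary: p v)
    case 0
    then obtain a where "p = [:a:]" "a \<noteq> 0"
      by (metis degree_eq_zeroE pCons_0_0)
    with 0 have "v = 0" by simp
    then show ?case using zero by simp
  next
    case (Suc d)
    have "\<not> constant (poly p)"
      using Suc.hyps(2) by (simp add: constant_degree)
    then obtain l where "poly p l = 0"
      using fundamental_theorem_of_algebra by blast
    then obtain q where q: "p = [:- l, 1:] * q"
      by (auto simp: poly_eq_0_iff_dvd)
    have "q \<noteq> 0" using q Suc.prems(1) by auto
    then have d: "d = degree q"
      using Suc.hyps(2) unfolding q by (subst (asm) degree_mult_eq) auto
    have eig: "M *v poly_action M q v - l *s poly_action M q v = 0"
      using Suc.prems(2) unfolding q poly_action_linear_factor .
    show ?case
    proof (cases "poly_action M q v = 0")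
      case True
      then show ?thesis using Suc.hyps(1)[OF d \<open>q \<noteq> 0\<close>] by blast
    next
      case False
      have "P (M *v v - l *s v)"
        using Suc.hyps(1)[OF d \<open>q \<noteq> 0\<close>] eig by (simp add: poly_action_diff_scale)
      then show ?thesis
        using step[of "poly_action M q v" l v] False eig by simp
    qed
  qed
qed

text \<open>An annihilating polynomial acts on an eigenvector as multiplication by
  \<open>poly p l\<close>, so every eigenvalue is among its finitely many roots. This and
  nonemptiness give the \<open>Max\<close> in \<open>spec_radius\<close> its meaning.\<close>

lemma finite_complex_eigenvalues: "finite (complex_eigenvalues M)"
proof -
  obtain p where p: "p \<noteq> 0" "\<And>v. poly_action (complexify M) p v = 0"
    using annihilating_poly_exists by blast
  have "complex_eigenvalues M \<subseteq> {l. poly p l = 0}"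
    using p(2) poly_action_eigenvector[of "complexify M" _ _ p] by (auto simp: complex_eigenvalues_def)
  then show ?thesis
    using poly_roots_finite[OF p(1)] finite_subset by blast
qed

text \<open>Without eigenvalues the step case of \<open>eigenvalue_induct\<close> is vacuous, and
  the induction would make every vector zero.\<close>

lemma complex_eigenvalues_nonempty:
  fixes M :: "real^'n^'n"
  shows "complex_eigenvalues M \<noteq> {}"
proof
  assume empty: "complex_eigenvalues M = {}"
  have "v = 0" for v :: "complex^'n"
    by (rule eigenvalue_induct[of "\<lambda>v. v = 0" "complexify M"])
      (use empty in \<open>auto simp: complex_eigenvalues_def\<close>)
  then have "axis undefined 1 = (0 :: complex^'n)" by blast
  then show False by (simp add: axis_eq_0_iff)
qed

lemma spec_radius_less_iff:
  "spec_radius M < r \<longleftrightarrow> (\<forall>l\<in>complex_eigenvalues M. cmod l < r)"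
  unfolding spec_radius_def
  using finite_complex_eigenvalues complex_eigenvalues_nonempty by (subst Max_less_iff) auto

text \<open>A stable scalar recursion with vanishing input; coordinates of trajectories obey one
  once an eigenvalue is split off.\<close>

lemma tendsto_0_affine_recurrence:
  fixes x w :: "nat \<Rightarrow> complex"
  assumes l: "cmod l < 1" and w: "w \<longlonglongrightarrow> 0" and x: "\<And>k. x (Suc k) = l * x k + w k"
  shows "x \<longlonglongrightarrow> 0"
proof (rule LIMSEQ_I)
  fix e :: real assume e: "0 < e"
  define r where "r = cmod l"
  have r: "0 \<le> r" "r < 1" using l by (simp_all add: r_def)
  \<comment> \<open>This threshold for \<open>w\<close> makes \<open>e / 2\<close> a fixed point of
    the recursion for the norms; the contribution of \<open>x N\<close> decays
    geometrically.\<close>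
  have "0 < (1 - r) * (e / 2)" using e r by simp
  with w obtain N where N: "\<And>k. k \<ge> N \<Longrightarrow> cmod (w k) < (1 - r) * (e / 2)"
    using LIMSEQ_D[of w 0 "(1 - r) * (e / 2)"] by (metis diff_zero)
  have bound: "cmod (x (N + k)) \<le> e / 2 + r ^ k * cmod (x N)" for k
  proof (induction k)
    case (Suc k)
    have "cmod (x (N + Suc k)) \<le> r * cmod (x (N + k)) + cmod (w (N + k))"
      using norm_triangle_ineq[of "l * x (N + k)" "w (N + k)"] by (simp add: x norm_mult r_def)
    also have "\<dots> \<le> r * (e / 2 + r ^ k * cmod (x N)) + (1 - r) * (e / 2)"
      using Suc r N[of "N + k"] by (intro add_mono mult_left_mono) auto
    finally show ?case by (simp add: field_simps)
  qed (use e in simp)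
  have "(\<lambda>k. r ^ k * cmod (x N)) \<longlonglongrightarrow> 0"
    using r by (intro tendsto_mult_left_zero LIMSEQ_power_zero) auto
  then obtain k0 where k0: "\<And>k. k \<ge> k0 \<Longrightarrow> r ^ k * cmod (x N) < e / 2"
    using LIMSEQ_D[of _ 0 "e / 2"] e by (metis diff_zero abs_less_iff half_gt_zero real_norm_def)
  have "cmod (x k) < e" if "k \<ge> N + k0" for k
  proof -
    have "k0 \<le> k - N" "N + (k - N) = k" using that by auto
    then show ?thesis using bound[of "k - N"] k0[of "k - N"] by simp
  qed
  then show "\<exists>no. \<forall>k\<ge>no. cmod (x k - 0) < e" by auto
qed

section \<open>From the spectral radius to convergence of trajectories\<close>

definition vanishing_powers :: "real^'n^'n \<Rightarrow> bool" where
  "vanishing_powers F \<longleftrightarrow> (\<forall>x. (\<lambda>k. ((*v) F ^^ k) x) \<longlonglongrightarrow> 0)"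

lemma vanishing_powers_of_spec_radius:
  assumes "spec_radius F < 1"
  shows "vanishing_powers F"
proof -
  define M where "M = complexify F"
  \<comment> \<open>The trajectory started at \<open>M *v v - l *s v\<close> is the input
    \<open>w\<close> of the affine recurrence obeyed by the trajectory of \<open>v\<close>.\<close>
  have lin: "((*v) M ^^ k) (M *v v - l *s v) = ((*v) M ^^ Suc k) v - l *s ((*v) M ^^ k) v" for k l v
    by (induction k) (simp_all add: matrix_vector_mult_diff_distrib vec.scale)
  have lim: "\<forall>i. (\<lambda>k. ((*v) M ^^ k) v $ i) \<longlonglongrightarrow> 0" for v
  proof (rule eigenvalue_induct[of _ M])
    have "((*v) M ^^ k) 0 = 0" for k by (induction k) simp_all
    then show "\<forall>i. (\<lambda>k. ((*v) M ^^ k) 0 $ i) \<longlonglongrightarrow> 0" by simp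
  next
    fix l u v
    assume u: "u \<noteq> 0" "M *v u = l *s u"
      and IH: "\<forall>i. (\<lambda>k. ((*v) M ^^ k) (M *v v - l *s v) $ i) \<longlonglongrightarrow> 0"
    have "cmod l < 1"
      using assms u by (auto simp: spec_radius_less_iff complex_eigenvalues_def M_def)
    then have "(\<lambda>k. ((*v) M ^^ k) v $ i) \<longlonglongrightarrow> 0" for i
      by (rule tendsto_0_affine_recurrence[OF _ IH[rule_format, of i]]) (simp add: lin)
    then show "\<forall>i. (\<lambda>k. ((*v) M ^^ k) v $ i) \<longlonglongrightarrow> 0"
      by blast
  qed
  \<comment> \<open>The complex trajectory of a real vector is the real trajectory, which thus
    inherits the limit.\<close>
  have re: "((*v) M ^^ k) (\<chi> i. complex_of_real (x $ i)) = (\<chi> i. complex_of_real (((*v) F ^^ k) x $ i))" for k x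
    by (induction k) (simp_all add: M_def complexify_def matrix_vector_mult_def vec_eq_iff)
  have "(\<lambda>k. ((*v) F ^^ k) x) \<longlonglongrightarrow> 0" for x
  proof (rule vec_tendstoI)
    fix i
    show "(\<lambda>k. ((*v) F ^^ k) x $ i) \<longlonglongrightarrow> 0 $ i"
      using lim[of "\<chi> i. complex_of_real (x $ i)", rule_format, of i]
      by (simp add: re tendsto_of_real_iff[of _ 0, where 'a=complex, simplified])
  qed
  then show ?thesis by (simp add: vanishing_powers_def)
qed

lemma vanishing_powers_scaleR:
  assumes "vanishing_powers F" "0 \<le> c" "c \<le> 1"
  shows "vanishing_powers (c *\<^sub>R F)"
  unfolding vanishing_powers_def
proof
  fix x
  have eq: "((*v) (c *\<^sub>R F) ^^ k) x = c ^ k *\<^sub>R ((*v) F ^^ k) x" for k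
    by (induction k) (simp_all add: matrix_vector_mult_scaleR flip: scaleR_matrix_vector_assoc)
  have "(\<lambda>k. ((*v) F ^^ k) x) \<longlonglongrightarrow> 0"
    using assms(1) by (simp add: vanishing_powers_def)
  then show "(\<lambda>k. ((*v) (c *\<^sub>R F) ^^ k) x) \<longlonglongrightarrow> 0"
  proof (rule Lim_null_comparison[rotated, OF tendsto_norm_zero], intro always_eventually allI)
    fix k
    show "norm (((*v) (c *\<^sub>R F) ^^ k) x) \<le> norm (((*v) F ^^ k) x)"
      using assms(2,3) by (simp add: eq mult_left_le_one_le power_le_one)
  qed
qed

section \<open>The discrete Lyapunov equation\<close>

lemma inner_transpose_matrix:
  fixes F :: "real^'c^'r"
  shows "x \<bullet> (transpose F *v y) = (F *v x) \<bullet> y"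
  by (metis dot_lmul_matrix vector_transpose_matrix)

lemma inner_congruence:
  fixes F :: "real^'c^'r"
  shows "x \<bullet> ((transpose F ** X ** F) *v y) = (F *v x) \<bullet> (X *v (F *v y))"
proof -
  have "x \<bullet> ((transpose F ** X ** F) *v y) = x \<bullet> (transpose F *v (X *v (F *v y)))"
    by (simp only: matrix_vector_mul_assoc matrix_mul_assoc)
  also have "\<dots> = (F *v x) \<bullet> (X *v (F *v y))"
    by (rule inner_transpose_matrix)
  finally show ?thesis .
qed

lemma matrix_eq_inner:
  fixes X Y :: "real^'n^'n"
  assumes "\<And>x y. x \<bullet> (X *v y) = x \<bullet> (Y *v y)"
  shows "X = Y"
  by (metis assms matrix_eq vector_eq_ldot)

lemma tendsto_bilinear_form:
  fixes X :: "real^'n^'n"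
  assumes "f \<longlonglongrightarrow> 0" "g \<longlonglongrightarrow> 0"
  shows "(\<lambda>k. f k \<bullet> (X *v g k)) \<longlonglongrightarrow> 0"
proof -
  have "(\<lambda>k. X *v g k) \<longlonglongrightarrow> X *v 0"
    by (intro isCont_tendsto_compose[OF _ assms(2)] linear_continuous_at matrix_vector_mul_bounded_linear)
  then have "(\<lambda>k. f k \<bullet> (X *v g k)) \<longlonglongrightarrow> 0 \<bullet> (X *v 0)"
    by (intro tendsto_inner assms(1))
  then show ?thesis by simp
qed

text \<open>Iterating the equation, the form at \<open>x\<close>, \<open>y\<close> equals the form
  at their \<open>k\<close>-th iterates under \<open>F\<close>; it is constant in \<open>k\<close>
  and tends to 0.\<close>

lemma stein_homogeneous_eq_0:
  assumes F: "vanishing_powers F" and X: "transpose F ** X ** F = X"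
  shows "X = 0"
proof (rule matrix_eq_inner)
  fix x y
  have "x \<bullet> (X *v y) = (((*v) F ^^ k) x) \<bullet> (X *v ((*v) F ^^ k) y)" for k
    by (induction k) (simp_all add: X flip: inner_congruence)
  moreover have "(\<lambda>k. (((*v) F ^^ k) x) \<bullet> (X *v ((*v) F ^^ k) y)) \<longlonglongrightarrow> 0"
    using F by (intro tendsto_bilinear_form) (auto simp: vanishing_powers_def)
  ultimately have "(\<lambda>k. x \<bullet> (X *v y)) \<longlonglongrightarrow> 0"
    by simp
  then show "x \<bullet> (X *v y) = x \<bullet> (0 *v y)"
    by (simp add: LIMSEQ_const_iff)
qed

lemma stein_solution_exists:
  fixes F :: "real^'n^'n"
  assumes F: "vanishing_powers F"
  obtains P where "transpose F ** P ** F - P + W = 0"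
proof -
  define L where "L X = transpose F ** X ** F - X" for X
  have L_inner: "x \<bullet> (L X *v y) = (F *v x) \<bullet> (X *v (F *v y)) - x \<bullet> (X *v y)" for X x y
    by (simp add: L_def matrix_vector_mult_diff_rdistrib inner_diff_right inner_congruence)
  have lin: "linear L"
  proof (rule linearI; rule matrix_eq_inner)
    fix X Y x y
    show "x \<bullet> (L (X + Y) *v y) = x \<bullet> ((L X + L Y) *v y)"
      by (simp add: L_inner matrix_vector_mult_add_rdistrib inner_add_right)
  next
    fix c X x y
    show "x \<bullet> (L (c *\<^sub>R X) *v y) = x \<bullet> ((c *\<^sub>R L X) *v y)"
      by (simp add: L_inner right_diff_distrib flip: scaleR_matrix_vector_assoc)
  qed
  moreover have "inj L"
    unfolding linear_injective_0[OF lin]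
    using stein_homogeneous_eq_0[OF F] by (auto simp: L_def)
  ultimately have "surj L"
    using linear_injective_imp_surjective by blast
  then obtain P where "L P = - W" by (metis surjD)
  then show ?thesis using that[of P] by (simp add: L_def)
qed

lemma transpose_diff: "transpose (X - Y) = transpose X - transpose (Y :: 'a::ab_group_add^'n^'m)"
  by (simp add: transpose_def vec_eq_iff)

lemma transpose_add: "transpose (X + Y) = transpose X + transpose (Y :: 'a::ab_group_add^'n^'m)"
  by (simp add: transpose_def vec_eq_iff)

text \<open>Transposing the equation shows that \<open>transpose P\<close> solves it too, so
  \<open>transpose P - P\<close> solves the homogeneous one.\<close>

lemma stein_solution_symmetric:
  fixes F :: "real^'n^'n"
  assumes F: "vanishing_powers F" and P: "transpose F ** P ** F - P + W = 0"
    and W: "symmetric_matrix W"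
  shows "symmetric_matrix P"
proof -
  have "transpose (transpose F ** P ** F - P + W) = 0"
    unfolding P by (simp add: transpose_def vec_eq_iff)
  then have T: "transpose F ** transpose P ** F - transpose P + W = 0"
    using W by (simp add: symmetric_matrix_def transpose_add transpose_diff matrix_transpose_mul matrix_mul_assoc)
  have "transpose F ** (transpose P - P) ** F = (transpose F ** transpose P ** F) - transpose F ** P ** F"
    by (rule matrix_eq_inner)
      (simp only: inner_congruence matrix_vector_mult_diff_rdistrib inner_diff_right)
  also have "\<dots> = transpose P - P"
  proof -
    have "transpose F ** P ** F = P - W" "transpose F ** transpose P ** F = transpose P - W"
      using arg_cong[OF P, of "\<lambda>X. X + (P - W)"] arg_cong[OF T, of "\<lambda>X. X + (transpose P - W)"]
      by simp_all
    then show ?thesis by simp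
  qed
  finally have "transpose P - P = 0"
    by (rule stein_homogeneous_eq_0[OF F])
  then show ?thesis by (simp add: symmetric_matrix_def)
qed

text \<open>The form does not increase along a trajectory and tends to 0 there, so its initial value
  is at least 0.\<close>

lemma nonneg_of_decreasing_form:
  assumes F: "vanishing_powers F"
    and D: "\<And>x. (F *v x) \<bullet> (D *v (F *v x)) \<le> x \<bullet> (D *v x)"
  shows "0 \<le> x \<bullet> (D *v x)"
proof -
  have "(((*v) F ^^ k) x) \<bullet> (D *v ((*v) F ^^ k) x) \<le> x \<bullet> (D *v x)" for k
    by (induction k) (auto intro: order_trans[OF D])
  moreover have "(\<lambda>k. (((*v) F ^^ k) x) \<bullet> (D *v ((*v) F ^^ k) x)) \<longlonglongrightarrow> 0"
    using F by (intro tendsto_bilinear_form) (auto simp: vanishing_powers_def)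
  ultimately show ?thesis
    by (intro LIMSEQ_le_const2) auto
qed

text \<open>For an eigenvector \<open>v = a + i b\<close>, the sum \<open>V a + V b\<close> is the
  real part of \<open>v^H P v\<close>. Applying \<open>F\<close> multiplies it by
  \<open>|l|^2\<close>, and strict decrease forces this factor below 1.\<close>

lemma spec_radius_less_one_of_decreasing_form:
  fixes F P :: "real^'n^'n"
  assumes pos: "\<And>x. x \<noteq> 0 \<Longrightarrow> 0 < x \<bullet> (P *v x)"
    and dec: "\<And>x. x \<noteq> 0 \<Longrightarrow> (F *v x) \<bullet> (P *v (F *v x)) < x \<bullet> (P *v x)"
  shows "spec_radius F < 1"
  unfolding spec_radius_less_iff
proof
  fix l assume "l \<in> complex_eigenvalues F"
  then obtain v where v: "v \<noteq> 0" "complexify F *v v = l *s v"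
    by (auto simp: complex_eigenvalues_def)
  define V where "V x = x \<bullet> (P *v x)" for x
  define a where "a = (\<chi> i. Re (v $ i))"
  define b where "b = (\<chi> i. Im (v $ i))"
  have row: "(\<Sum>j\<in>UNIV. complex_of_real (F $ i $ j) * v $ j) = l * v $ i" for i
    using v(2) by (simp add: vec_eq_iff complexify_def matrix_vector_mult_def)
  have Fa: "F *v a = Re l *\<^sub>R a - Im l *\<^sub>R b"
    using arg_cong[OF row, of Re] by (simp add: vec_eq_iff a_def b_def matrix_vector_mult_def)
  have Fb: "F *v b = Im l *\<^sub>R a + Re l *\<^sub>R b"
    using arg_cong[OF row, of Im] by (simp add: vec_eq_iff a_def b_def matrix_vector_mult_def algebra_simps)
  \<comment> \<open>The mixed terms in \<open>a\<close> and \<open>b\<close> cancel between the two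
    summands.\<close>
  have eq: "V (F *v a) + V (F *v b) = (cmod l)\<^sup>2 * (V a + V b)"
    unfolding Fa Fb cmod_power2 V_def
    by (simp add: matrix_vector_right_distrib matrix_vector_mult_diff_distrib matrix_vector_mult_scaleR
        inner_simps power2_eq_square algebra_simps)
  have ab: "a \<noteq> 0 \<or> b \<noteq> 0"
    using v(1) by (auto simp: vec_eq_iff a_def b_def complex_eq_iff)
  \<comment> \<open>One of \<open>a\<close>, \<open>b\<close> may be zero: the weak bounds serve for
    it, the other supplies strictness.\<close>
  have le: "0 \<le> V x" "V (F *v x) \<le> V x" for x
    using pos[of x] dec[of x] by (cases "x = 0"; simp add: V_def)+
  have "V (F *v a) + V (F *v b) < V a + V b"
    using ab le[of a] le[of b] dec[of a] dec[of b] by (auto simp: V_def)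
  moreover have "0 < V a + V b"
    using ab le[of a] le[of b] pos[of a] pos[of b] by (auto simp: V_def)
  ultimately have "(cmod l)\<^sup>2 < 1"
    unfolding eq by (simp add: mult_less_cancel_right2)
  then show "cmod l < 1"
    by (simp add: power_less_one_iff abs_square_less_1)
qed

section \<open>Robustness of stability under small perturbations\<close>

lemma bilinear_form_bound:
  fixes E G P :: "real^'n^'n"
  obtains C where "0 \<le> C" "\<And>x. (E *v x) \<bullet> (P *v (G *v x)) \<le> C * (x \<bullet> x)"
proof -
  obtain c where c: "\<And>x. norm ((transpose E ** P ** G) *v x) \<le> norm x * c" "0 < c"
    using bounded_linear.pos_bounded[OF matrix_vector_mul_bounded_linear[of "transpose E ** P ** G"]] by blast
  have "(E *v x) \<bullet> (P *v (G *v x)) \<le> c * (x \<bullet> x)" for x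
  proof -
    have "(E *v x) \<bullet> (P *v (G *v x)) = x \<bullet> ((transpose E ** P ** G) *v x)"
      by (metis inner_transpose_matrix matrix_vector_mul_assoc)
    also have "\<dots> \<le> norm x * (norm x * c)"
      using norm_cauchy_schwarz[of x] c(1)[of x] by (meson mult_left_mono norm_ge_zero order_trans)
    finally show ?thesis
      by (simp add: dot_square_norm power2_eq_square mult_ac)
  qed
  then show ?thesis using that[of c] c(2) by simp
qed

lemma spec_radius_small_perturbation:
  fixes F N :: "real^'n^'n"
  assumes F: "vanishing_powers F"
  obtains a where "0 < a" "a \<le> 1" "spec_radius (F + a *\<^sub>R N) < 1"
proof -
  obtain P where P: "transpose F ** P ** F - P + mat 1 = 0"
    using stein_solution_exists[OF F] by blast
  have VF: "(F *v x) \<bullet> (P *v (F *v x)) = x \<bullet> (P *v x) - x \<bullet> x" for x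
  proof -
    have "x \<bullet> ((transpose F ** P ** F - P + mat 1) *v x) = 0"
      unfolding P by simp
    then show ?thesis
      by (simp add: matrix_vector_mult_add_rdistrib matrix_vector_mult_diff_rdistrib inner_simps inner_congruence)
  qed
  \<comment> \<open>Decrease along trajectories gives nonnegativity; strictness follows because the
    value at \<open>x\<close> exceeds the value at \<open>F *v x\<close> by
    \<open>x \<bullet> x\<close>.\<close>
  have nonneg: "0 \<le> x \<bullet> (P *v x)" for x
    by (rule nonneg_of_decreasing_form[OF F]) (simp add: VF)
  have pos: "0 < x \<bullet> (P *v x)" if "x \<noteq> 0" for x
  proof -
    have "0 < x \<bullet> x" using that by simp
    then show ?thesis using VF[of x] nonneg[of "F *v x"] by linarith
  qed
  obtain C1 where C1: "0 \<le> C1" "\<And>x. (F *v x) \<bullet> (P *v (N *v x)) \<le> C1 * (x \<bullet> x)"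
    using bilinear_form_bound by blast
  obtain C2 where C2: "0 \<le> C2" "\<And>x. (N *v x) \<bullet> (P *v (F *v x)) \<le> C2 * (x \<bullet> x)"
    using bilinear_form_bound by blast
  obtain C3 where C3: "0 \<le> C3" "\<And>x. (N *v x) \<bullet> (P *v (N *v x)) \<le> C3 * (x \<bullet> x)"
    using bilinear_form_bound by blast
  \<comment> \<open>As \<open>a * a \<le> a\<close>, the perturbation terms add at most
    \<open>a * (C1 + C2 + C3) * (x \<bullet> x)\<close>, which must stay below the decrease
    \<open>x \<bullet> x\<close>. The summand 1 ensures this and \<open>a \<le> 1\<close>.\<close>
  define a where "a = 1 / (1 + C1 + C2 + C3)"
  have a: "0 < a" "a \<le> 1" "a * (C1 + C2 + C3) < 1"
    using C1(1) C2(1) C3(1) by (simp_all add: a_def)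
  have dec: "((F + a *\<^sub>R N) *v x) \<bullet> (P *v ((F + a *\<^sub>R N) *v x)) < x \<bullet> (P *v x)" if "x \<noteq> 0" for x
  proof -
    have "((F + a *\<^sub>R N) *v x) \<bullet> (P *v ((F + a *\<^sub>R N) *v x))
        = (F *v x) \<bullet> (P *v (F *v x)) + a * ((F *v x) \<bullet> (P *v (N *v x)))
          + a * ((N *v x) \<bullet> (P *v (F *v x))) + a * (a * ((N *v x) \<bullet> (P *v (N *v x))))"
      by (simp add: matrix_vector_mult_add_rdistrib matrix_vector_right_distrib matrix_vector_mult_scaleR
          inner_simps algebra_simps flip: scaleR_matrix_vector_assoc)
    also have "\<dots> \<le> (x \<bullet> (P *v x) - x \<bullet> x) + a * (C1 * (x \<bullet> x)) + a * (C2 * (x \<bullet> x)) + a * (1 * (C3 * (x \<bullet> x)))"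
    proof (intro add_mono mult_left_mono)
      have "a * ((N *v x) \<bullet> (P *v (N *v x))) \<le> a * (C3 * (x \<bullet> x))"
        using a(1) C3(2) by (intro mult_left_mono) auto
      also have "\<dots> \<le> 1 * (C3 * (x \<bullet> x))"
        using a(2) C3(1) by (intro mult_right_mono) auto
      finally show "a * ((N *v x) \<bullet> (P *v (N *v x))) \<le> 1 * (C3 * (x \<bullet> x))" .
    qed (use a C1 C2 VF in auto)
    also have "\<dots> = x \<bullet> (P *v x) - (1 - a * (C1 + C2 + C3)) * (x \<bullet> x)"
      by (simp add: algebra_simps)
    also have "\<dots> < x \<bullet> (P *v x)"
      using a(3) that by simp
    finally show ?thesis .
  qed
  show ?thesis
    using that[OF a(1,2)] spec_radius_less_one_of_decreasing_form[of P, OF pos dec] by blast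
qed

section \<open>Policy improvement\<close>

lemma lyapunov_solution_stein:
  "lyapunov_solution A B Q R \<gamma> K P \<longleftrightarrow>
     transpose (sqrt \<gamma> *\<^sub>R (A + B ** K)) ** P ** (sqrt \<gamma> *\<^sub>R (A + B ** K)) - P
       + (transpose K ** R ** K + Q) = 0"
  by (simp add: lyapunov_solution_def transpose_scalar add.assoc)

text \<open>The Bellman equation of the policy \<open>K\<close>: value equals stage cost plus
  discounted value of the next state.\<close>

lemma lyapunov_solution_form:
  assumes "lyapunov_solution A B Q R \<gamma> K P" "0 \<le> \<gamma>"
  shows "x \<bullet> (P *v x) = \<gamma> * (((A + B ** K) *v x) \<bullet> (P *v ((A + B ** K) *v x)))
           + (K *v x) \<bullet> (R *v (K *v x)) + x \<bullet> (Q *v x)"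
proof -
  define M where "M = A + B ** K"
  have "x \<bullet> ((transpose (sqrt \<gamma> *\<^sub>R M) ** P ** (sqrt \<gamma> *\<^sub>R M) - P + (transpose K ** R ** K + Q)) *v x) = 0"
    using assms(1) by (simp add: lyapunov_solution_stein M_def)
  then have "((sqrt \<gamma> *\<^sub>R M) *v x) \<bullet> (P *v ((sqrt \<gamma> *\<^sub>R M) *v x)) - x \<bullet> (P *v x)
      + (K *v x) \<bullet> (R *v (K *v x)) + x \<bullet> (Q *v x) = 0"
    by (simp add: matrix_vector_mult_add_rdistrib matrix_vector_mult_diff_rdistrib inner_simps inner_congruence)
  then show ?thesis
    using assms(2) by (simp add: M_def matrix_vector_mult_scaleR flip: scaleR_matrix_vector_assoc mult.assoc)
qed

lemma stabilizing_vanishing_powers: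
  assumes "K \<in> stabilizing_gains A B" "0 \<le> \<gamma>" "\<gamma> \<le> 1"
  shows "vanishing_powers (A + B ** K)" "vanishing_powers (sqrt \<gamma> *\<^sub>R (A + B ** K))"
proof -
  show "vanishing_powers (A + B ** K)"
    using assms(1) by (intro vanishing_powers_of_spec_radius) (simp add: stabilizing_gains_def)
  then show "vanishing_powers (sqrt \<gamma> *\<^sub>R (A + B ** K))"
    using assms(2,3) by (intro vanishing_powers_scaleR) auto
qed

lemma pos_def_form_nonneg:
  assumes "pos_def X"
  shows "0 \<le> x \<bullet> (X *v x)"
  using assms by (cases "x = 0") (auto simp: pos_def_def less_imp_le)

lemma symmetric_stage_cost:
  assumes "symmetric_matrix Q" "symmetric_matrix R"
  shows "symmetric_matrix (transpose K ** R ** K + Q)"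
  using assms by (simp add: symmetric_matrix_def transpose_add matrix_transpose_mul matrix_mul_assoc)

text \<open>Stage costs are nonnegative, so by the Bellman equation the form of \<open>P\<close>
  does not increase along the scaled closed loop.\<close>

lemma lyapunov_solution_pos_semidef:
  assumes K: "K \<in> stabilizing_gains A B" and \<gamma>: "0 \<le> \<gamma>" "\<gamma> \<le> 1"
    and QR: "pos_def Q" "pos_def R" and P: "lyapunov_solution A B Q R \<gamma> K P"
  shows "pos_semidef P"
  unfolding pos_semidef_def
proof (intro conjI allI)
  note F = stabilizing_vanishing_powers(2)[OF K \<gamma>]
  show "symmetric_matrix P"
    using F P[unfolded lyapunov_solution_stein]
    by (rule stein_solution_symmetric) (use QR in \<open>simp add: symmetric_stage_cost pos_def_def\<close>)
  show "0 \<le> x \<bullet> (P *v x)" for x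
  proof (rule nonneg_of_decreasing_form[OF F])
    fix x
    show "((sqrt \<gamma> *\<^sub>R (A + B ** K)) *v x) \<bullet> (P *v ((sqrt \<gamma> *\<^sub>R (A + B ** K)) *v x)) \<le> x \<bullet> (P *v x)"
      using lyapunov_solution_form[OF P \<gamma>(1), of x] pos_def_form_nonneg[OF QR(1), of x] pos_def_form_nonneg[OF QR(2), of "K *v x"] \<gamma>(1)
      by (simp add: matrix_vector_mult_scaleR flip: scaleR_matrix_vector_assoc mult.assoc)
  qed
qed

section \<open>The cost of a stabilizing gain as a quadratic form\<close>

lemma closed_loop_state_funpow:
  "closed_loop_state A B K x k = ((*v) (A + B ** K) ^^ k) x"
  by (induction k) (simp_all add: matrix_vector_mult_add_rdistrib matrix_vector_mul_assoc)

lemma discounted_cost_eq_form: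
  assumes K: "K \<in> stabilizing_gains A B" and \<gamma>: "0 \<le> \<gamma>" "\<gamma> \<le> 1"
    and P: "lyapunov_solution A B Q R \<gamma> K P"
  shows "discounted_cost A B Q R \<gamma> x K = x \<bullet> (P *v x)"
proof -
  define X where "X k = ((*v) (A + B ** K) ^^ k) x" for k
  define V where "V k = \<gamma> ^ k * (X k \<bullet> (P *v X k))" for k
  have "X \<longlonglongrightarrow> 0"
    using stabilizing_vanishing_powers(1)[OF K \<gamma>] unfolding vanishing_powers_def X_def by blast
  then have "(\<lambda>k. X k \<bullet> (P *v X k)) \<longlonglongrightarrow> 0"
    by (intro tendsto_bilinear_form)
  \<comment> \<open>The factors \<open>\<gamma> ^ k\<close> are at most 1, so the decay comes from
    \<open>X\<close>, also for \<open>\<gamma> = 1\<close>.\<close>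
  then have "V \<longlonglongrightarrow> 0"
  proof (rule Lim_null_comparison[rotated, OF tendsto_norm_zero], intro always_eventually allI)
    fix k
    show "norm (V k) \<le> norm (X k \<bullet> (P *v X k))"
      using \<gamma> by (simp add: V_def abs_mult mult_left_le_one_le power_le_one)
  qed
  \<comment> \<open>The differences turn out to be the discounted stage costs. \<open>V 0\<close> is
    the form at \<open>x\<close>, as \<open>\<gamma> ^ 0 = 1\<close> even for
    \<open>\<gamma> = 0\<close>.\<close>
  then have "(\<lambda>k. V k - V (Suc k)) sums (V 0 - 0)"
    by (rule telescope_sums')
  moreover have "V k - V (Suc k) = \<gamma> ^ k * (X k \<bullet> (Q *v X k) + (K *v X k) \<bullet> (R *v (K *v X k)))" for k
    using lyapunov_solution_form[OF P \<gamma>(1), of "X k"]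
    by (simp add: V_def X_def algebra_simps)
  ultimately show ?thesis
    unfolding discounted_cost_def Let_def closed_loop_state_funpow
    by (simp add: V_def X_def sums_iff)
qed

section \<open>Completing the square for the greedy step\<close>

lemma inner_symmetric_matrix:
  assumes "symmetric_matrix X"
  shows "x \<bullet> (X *v y) = y \<bullet> (X *v x)"
proof -
  have "x \<bullet> (X *v y) = (transpose X *v x) \<bullet> y"
    by (simp add: dot_lmul_matrix)
  also have "\<dots> = y \<bullet> (X *v x)"
    using assms by (subst inner_commute) (simp only: symmetric_matrix_def)
  finally show ?thesis .
qed

text \<open>\<open>matrix_inv\<close> is a choice operator, so its defining property rests on
  invertibility, which follows from the trivial kernel.\<close>

lemma pos_def_matrix_inv:
  fixes S :: "real^'n^'n"
  assumes "pos_def S"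
  shows "S ** matrix_inv S = mat 1"
proof -
  have "x = 0" if "S *v x = 0" for x
    using assms that unfolding pos_def_def by (metis inner_zero_right less_irrefl)
  then have "invertible S"
    by (simp add: invertible_left_inverse matrix_left_invertible_ker)
  then show ?thesis
    unfolding invertible_def matrix_inv_def by (rule someI_ex[THEN conjunct1])
qed

text \<open>Completing the square: with \<open>S = R + \<gamma> B\<^sup>T P B\<close> and \<open>w\<close> the input proposed by the greedy
  gain, the cost-to-go of input \<open>u\<close> exceeds its minimum by \<open>\<langle>u - w, S (u - w)\<rangle>\<close>, and a step of
  size \<open>\<alpha>\<close> multiplies \<open>u - w\<close> by \<open>1 - \<alpha>\<close>.\<close>

lemma improved_gain_decreases_cost_to_go:
  fixes A :: "real^'n^'n" and B :: "real^'m^'n"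
  assumes P: "pos_semidef P" and R: "pos_def R" and \<gamma>: "0 \<le> \<gamma>" and a: "0 \<le> a" "a \<le> 1"
    and K': "K' = improved_gain A B R \<gamma> P a K"
  shows "\<gamma> * (((A + B ** K') *v x) \<bullet> (P *v ((A + B ** K') *v x))) + (K' *v x) \<bullet> (R *v (K' *v x))
       \<le> \<gamma> * (((A + B ** K) *v x) \<bullet> (P *v ((A + B ** K) *v x))) + (K *v x) \<bullet> (R *v (K *v x))"
proof -
  define S where "S = R + \<gamma> *\<^sub>R (transpose B ** P ** B)"
  define w where "w = - (\<gamma> *\<^sub>R (matrix_inv S ** transpose B ** P ** A)) *v x"
  define y where "y = A *v x"
  define g where "g u = \<gamma> * ((y + B *v u) \<bullet> (P *v (y + B *v u))) + u \<bullet> (R *v u)" for u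
  have symP: "p \<bullet> (P *v q) = q \<bullet> (P *v p)" for p q
    using P inner_symmetric_matrix by (auto simp: pos_semidef_def)
  have S_inner: "p \<bullet> (S *v q) = p \<bullet> (R *v q) + \<gamma> * ((B *v p) \<bullet> (P *v (B *v q)))" for p q
    by (simp add: S_def matrix_vector_mult_add_rdistrib inner_simps inner_congruence flip: scaleR_matrix_vector_assoc)
  have S_nonneg: "0 \<le> p \<bullet> (S *v p)" for p
    using P pos_def_form_nonneg[OF R] \<gamma> by (simp add: S_inner pos_semidef_def)
  have "pos_def S"
    unfolding pos_def_def
  proof (intro conjI allI impI)
    show "symmetric_matrix S"
      using P R by (simp add: S_def symmetric_matrix_def pos_def_def pos_semidef_def transpose_add
          transpose_scalar matrix_transpose_mul matrix_mul_assoc)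
    show "0 < p \<bullet> (S *v p)" if "p \<noteq> 0" for p
      using that P R \<gamma> by (auto simp: S_inner pos_def_def pos_semidef_def intro: add_pos_nonneg)
  qed
  then have inv: "S ** matrix_inv S = mat 1"
    by (rule pos_def_matrix_inv)
  \<comment> \<open>Writing the negated matrix as \<open>0 - M\<close> lets distributivity over
    differences move the sign outside.\<close>
  have "w = - (\<gamma> *\<^sub>R (matrix_inv S *v (transpose B *v (P *v y))))"
    using matrix_vector_mult_diff_rdistrib[of 0 "\<gamma> *\<^sub>R (matrix_inv S ** transpose B ** P ** A)" x]
    by (simp only: w_def y_def diff_0 matrix_vector_mult_0 matrix_vector_mul_assoc matrix_mul_assoc
        scaleR_matrix_vector_assoc)
  then have "S *v w = - (\<gamma> *\<^sub>R (S *v (matrix_inv S *v (transpose B *v (P *v y)))))"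
    by (simp only: vec.neg matrix_vector_mult_scaleR)
  also have "\<dots> = - (\<gamma> *\<^sub>R (transpose B *v (P *v y)))"
    by (simp add: matrix_vector_mul_assoc matrix_mul_assoc inv)
  \<comment> \<open>The stationarity condition for \<open>g\<close>; it turns the linear term of
    \<open>g\<close> into \<open>- 2 * (u \<bullet> (S *v w))\<close>.\<close>
  finally have Sw: "p \<bullet> (S *v w) = - \<gamma> * ((B *v p) \<bullet> (P *v y))" for p
    by (simp only: inner_minus_right inner_scaleR_right inner_transpose_matrix mult_minus_left)
  have symS: "w \<bullet> (S *v u) = u \<bullet> (S *v w)" for u
    using \<open>pos_def S\<close> inner_symmetric_matrix by (auto simp: pos_def_def)
  have "g u = \<gamma> * (y \<bullet> (P *v y)) + 2 * (\<gamma> * ((B *v u) \<bullet> (P *v y))) + u \<bullet> (S *v u)" for u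
    by (simp add: g_def S_inner matrix_vector_right_distrib inner_simps symP[of y "B *v u"] algebra_simps)
  then have g: "g u = \<gamma> * (y \<bullet> (P *v y)) - 2 * (u \<bullet> (S *v w)) + u \<bullet> (S *v u)" for u
    by (simp add: Sw)
  have square: "g u = g w + (u - w) \<bullet> (S *v (u - w))" for u
    using symS[of u] by (simp add: g matrix_vector_mult_diff_distrib inner_diff_left inner_diff_right)
  have K'x: "K' *v x = a *\<^sub>R w + (1 - a) *\<^sub>R (K *v x)"
    unfolding K' improved_gain_def w_def S_def
    by (simp only: matrix_vector_mult_add_rdistrib scaleR_matrix_vector_assoc)
  have "K' *v x - w = (1 - a) *\<^sub>R (K *v x - w)"
    unfolding K'x by (simp add: algebra_simps)
  then have "(K' *v x - w) \<bullet> (S *v (K' *v x - w)) = (1 - a)\<^sup>2 * ((K *v x - w) \<bullet> (S *v (K *v x - w)))"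
    by (simp add: matrix_vector_mult_scaleR power2_eq_square)
  also have "\<dots> \<le> (K *v x - w) \<bullet> (S *v (K *v x - w))"
    using S_nonneg a by (intro mult_left_le_one_le) (auto simp: power_le_one)
  finally have "g (K' *v x) \<le> g (K *v x)"
    using square[of "K' *v x"] square[of "K *v x"] by linarith
  then show ?thesis
    by (simp add: g_def y_def matrix_vector_mult_add_rdistrib matrix_vector_mul_assoc)
qed

lemma lyapunov_solution_improves:
  fixes A :: "real^'n^'n" and B :: "real^'m^'n"
  assumes K: "K \<in> stabilizing_gains A B" and K': "K' \<in> stabilizing_gains A B"
    and \<gamma>: "0 \<le> \<gamma>" "\<gamma> \<le> 1" and QR: "pos_def Q" "pos_def R"
    and P: "lyapunov_solution A B Q R \<gamma> K P" and P': "lyapunov_solution A B Q R \<gamma> K' P'"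
    and a: "0 \<le> a" "a \<le> 1" and step: "K' = improved_gain A B R \<gamma> P a K"
  shows "loewner_le P' P"
  unfolding loewner_le_def pos_semidef_def
proof (intro conjI allI)
  have psd: "pos_semidef P" "pos_semidef P'"
    using lyapunov_solution_pos_semidef K K' \<gamma> QR P P' by blast+
  then show "symmetric_matrix (P - P')"
    by (simp add: pos_semidef_def symmetric_matrix_def transpose_diff)
  show "0 \<le> x \<bullet> ((P - P') *v x)" for x
  proof (rule nonneg_of_decreasing_form[OF stabilizing_vanishing_powers(2)[OF K' \<gamma>]])
    fix x
    \<comment> \<open>Inserting both Bellman equations into the cost-to-go inequality cancels the
      stage cost of \<open>K'\<close> and leaves the decrease of \<open>P - P'\<close>.\<close>
    show "((sqrt \<gamma> *\<^sub>R (A + B ** K')) *v x) \<bullet> ((P - P') *v ((sqrt \<gamma> *\<^sub>R (A + B ** K')) *v x))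
        \<le> x \<bullet> ((P - P') *v x)"
      using improved_gain_decreases_cost_to_go[OF psd(1) QR(2) \<gamma>(1) a step, of x]
        lyapunov_solution_form[OF P \<gamma>(1), of x] lyapunov_solution_form[OF P' \<gamma>(1), of x] \<gamma>(1)
      by (simp add: matrix_vector_mult_scaleR matrix_vector_mult_diff_rdistrib inner_simps right_diff_distrib
          flip: scaleR_matrix_vector_assoc mult.assoc)
  qed
qed

text \<open>The new gain is affine in \<open>a\<close> and equals \<open>K\<close> at
  \<open>a = 0\<close>, so the closed loop is perturbed by \<open>a\<close> times a fixed matrix;
  \<open>P\<close> affects only the direction.\<close>

lemma improved_gain_feasible:
  fixes A :: "real^'n^'n" and B :: "real^'m^'n"
  assumes K: "K \<in> stabilizing_gains A B"
  obtains a where "0 < a" "a \<le> 1" "improved_gain A B R \<gamma> P a K \<in> stabilizing_gains A B"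
proof -
  define N where "N = improved_gain A B R \<gamma> P 1 K - K"
  have step: "improved_gain A B R \<gamma> P a K = K + a *\<^sub>R N" for a
    by (simp add: improved_gain_def N_def algebra_simps)
  have "vanishing_powers (A + B ** K)"
    using K by (intro vanishing_powers_of_spec_radius) (simp add: stabilizing_gains_def)
  then obtain a where a: "0 < a" "a \<le> 1" "spec_radius (A + B ** K + a *\<^sub>R (B ** N)) < 1"
    by (rule spec_radius_small_perturbation)
  moreover have "A + B ** K + a *\<^sub>R (B ** N) = A + B ** (K + a *\<^sub>R N)"
    by (simp add: matrix_add_ldistrib matrix_scalar_ac scalar_matrix_assoc)
  ultimately show ?thesis
    using that[of a] by (simp add: step stabilizing_gains_def)
qed

text \<open>A run demands stability only from index 1 on; index 0 takes it from
  \<open>K0\<close>.\<close>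

lemma sPI_run_stabilizing:
  assumes "sPI_run A B Q R \<gamma> K0 N \<alpha> K P" "K0 \<in> stabilizing_gains A B" "j \<le> N"
  shows "K j \<in> stabilizing_gains A B" "lyapunov_solution A B Q R \<gamma> (K j) (P j)"
  using assms by (cases "j = 0"; auto simp: sPI_run_def)+

theorem theorem5:
  fixes A :: "real^'n^'n" and B :: "real^'m^'n"
    and Q :: "real^'n^'n" and R :: "real^'m^'m"
    and \<gamma> :: real and K0 :: "real^'n^'m"
  assumes "stabilizable A B"
    and "pos_def Q" and "pos_def R"
    and "0 \<le> \<gamma>" and "\<gamma> \<le> 1"
    and "K0 \<in> stabilizing_gains A B"
  shows "(\<forall>j>0. \<forall>\<alpha> K P. sPI_run A B Q R \<gamma> K0 (j - 1) \<alpha> K P \<longrightarrow>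
         (\<exists>\<alpha>j\<in>{0<..1}. \<exists>Kj\<in>stabilizing_gains A B. \<exists>Pj. symmetric_matrix Pj \<and>
            Kj = improved_gain A B R \<gamma> (P (j - 1)) \<alpha>j (K (j - 1)) \<and>
            lyapunov_solution A B Q R \<gamma> Kj Pj))
    \<and> (\<forall>\<alpha> K P. \<forall>j>0. sPI_run A B Q R \<gamma> K0 j \<alpha> K P \<longrightarrow>
         loewner_le (P j) (P (j - 1)) \<and>
         (\<forall>x0. discounted_cost A B Q R \<gamma> x0 (K j) - discounted_cost A B Q R \<gamma> x0 (K (j - 1)) \<le> 0))"
proof (intro conjI allI impI)
  fix j :: nat and \<alpha> K P
  assume "sPI_run A B Q R \<gamma> K0 (j - 1) \<alpha> K P"
  then have "K (j - 1) \<in> stabilizing_gains A B"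
    using sPI_run_stabilizing(1) assms(6) by blast
  then obtain a where a: "0 < a" "a \<le> 1"
    and K': "improved_gain A B R \<gamma> (P (j - 1)) a (K (j - 1)) \<in> stabilizing_gains A B"
    by (rule improved_gain_feasible)
  moreover obtain P' where P': "lyapunov_solution A B Q R \<gamma> (improved_gain A B R \<gamma> (P (j - 1)) a (K (j - 1))) P'"
    unfolding lyapunov_solution_stein
    using stein_solution_exists[OF stabilizing_vanishing_powers(2)[OF K' assms(4,5)]] by blast
  moreover have "symmetric_matrix P'"
    using lyapunov_solution_pos_semidef[OF K' assms(4,5,2,3) P'] by (simp add: pos_semidef_def)
  ultimately show "\<exists>\<alpha>j\<in>{0<..1}. \<exists>Kj\<in>stabilizing_gains A B. \<exists>Pj. symmetric_matrix Pj \<and>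
      Kj = improved_gain A B R \<gamma> (P (j - 1)) \<alpha>j (K (j - 1)) \<and> lyapunov_solution A B Q R \<gamma> Kj Pj"
    by (intro bexI[of _ a] bexI[OF _ K']) auto
next
  fix \<alpha> K P and j :: nat
  assume j: "0 < j" and run: "sPI_run A B Q R \<gamma> K0 j \<alpha> K P"
  note now = sPI_run_stabilizing[OF run assms(6) order_refl]
  \<comment> \<open>\<open>diff_le_self\<close> instantiates the index to \<open>j - 1\<close>,
    within the run of length \<open>j\<close>.\<close>
  note prev = sPI_run_stabilizing[OF run assms(6) diff_le_self, of 1]
  have "\<alpha> j \<in> {0<..1}" "K j = improved_gain A B R \<gamma> (P (j - 1)) (\<alpha> j) (K (j - 1))"
    using run j by (auto simp: sPI_run_def)
  then show le: "loewner_le (P j) (P (j - 1))"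
    using lyapunov_solution_improves[OF prev(1) now(1) assms(4,5,2,3) prev(2) now(2), of "\<alpha> j"] by simp
  \<comment> \<open>Both costs are the forms of \<open>P j\<close> and \<open>P (j - 1)\<close> at
    \<open>x0\<close>, so the matrix order gives the inequality.\<close>
  show "discounted_cost A B Q R \<gamma> x0 (K j) - discounted_cost A B Q R \<gamma> x0 (K (j - 1)) \<le> 0" for x0
    using le discounted_cost_eq_form[OF prev(1) assms(4,5) prev(2)]
      discounted_cost_eq_form[OF now(1) assms(4,5) now(2)]
    by (simp add: loewner_le_def pos_semidef_def matrix_vector_mult_diff_rdistrib inner_diff_right)
qed

end
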